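(* Let $X$ be a space, $m\ge2$, let $\mathrm{pr}_i\colon X^m\to X$ be the projection onto the $i$-th coordinate, and let $f\colon X\to Y$ be a map. Then $$\mathsf{cat}(f)=\mathsf{D}(f,* )=\mathsf{D}( *,f)\quad\text{and}\quad\mathsf{dcat}(f)=\mathsf{dD}(f,* )=\mathsf{dD}( *,f),$$ where $*\colon X\to Y$ is the constant map to a fixed basepoint $y_0\in Y$, and $$\mathsf{TC}_m(f)=\mathsf{D}(f\circ\mathrm{pr}_1,\dots,f\circ\mathrm{pr}_m)\quad\text{and}\quad\mathsf{dTC}_m(f)=\mathsf{dD}(f\circ\mathrm{pr}_1,\dots,f\circ\mathrm{pr}_m).$$
   Context: For a fibration $p\colon E\to B$, $\mathsf{secat}(p)$ is the least $n\ge 0$ such that $B$ is covered by $n+1$ open sets over each of which $p$ has a continuous partial section. For $k\ge1$ let $E_k(p)$ be the space of probability measures $\sum_{i=1}^k\lambda_ie_i$ on $E$ supported on at most $k$ points, all in a single fiber of $p$, as a subspace of the space $\mathcal B_k(E)$ of probability measures with support of size at most $k$ (with the L\'evy--Prokhorov metric topology when $E$ is metrizable; the results are asserted equally for the quotient topology from the symmetric join $\ast^kE/\Sigma_k$), and $p_k\colon E_k(p)\to B$, $p_k(\sum\lambda_ie_i)=p(e_i)$. $\mathsf{dsecat}(p)$ is the least $n\ge0$ such that $p_{n+1}$ has a continuous section. Fix times $0=t_1<\dots<t_m=1$ and let $\pi^Y_m\colon Y^I\to Y^m$, $\gamma\mapsto(\gamma(t_1),\dots,\gamma(t_m))$. For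 maps $g_1,\dots,g_m\colon X\to Y$ with $(g_1,\dots,g_m)(x)=(g_1(x),\dots,g_m(x))$: $\mathsf{D}(g_1,\dots,g_m)$ is the least $n\ge0$ such that $X$ is covered by $n+1$ open sets on each of which the restrictions of all the $g_i$ are mutually homotopic; equivalently $\mathsf{secat}((g_1,\dots,g_m)^*\pi^Y_m)$. $\mathsf{dD}(g_1,\dots,g_m):=\mathsf{dsecat}((g_1,\dots,g_m)^*\pi^Y_m)$. With $P_0(Y)\subset Y^I$ the paths ending at $y_0$ and $p^Y\colon P_0(Y)\to Y$, $\gamma\mapsto\gamma(0)$: $\mathsf{cat}(f):=\mathsf{secat}(f^*p^Y)$, $\mathsf{dcat}(f):=\mathsf{dsecat}(f^*p^Y)$. With $f^m\colon X^m\to Y^m$ the power map: $\mathsf{TC}_m(f):=\mathsf{secat}((f^m)^*\pi^Y_m)$, $\mathsf{dTC}_m(f):=\mathsf{dsecat}((f^m)^*\pi^Y_m)$. *)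

theory Defs
  imports "HOL-Analysis.Analysis" "HOL-Probability.Probability" "HOL-Homology.Simplices"
begin

section \<open>Path spaces and pullbacks\<close>

text \<open>
  The mapping space of continuous maps from \<open>K\<close> to \<open>Y\<close> with the compact-open topology.
  Maps are normalised to be \<open>undefined\<close> outside \<open>topspace K\<close>.
\<close>

definition mapping_space_carrier :: "'a topology \<Rightarrow> 'b topology \<Rightarrow> ('a \<Rightarrow> 'b) set" where
  "mapping_space_carrier K Y = {\<gamma> \<in> extensional (topspace K). continuous_map K Y \<gamma>}"

definition compact_open_topology :: "'a topology \<Rightarrow> 'b topology \<Rightarrow> ('a \<Rightarrow> 'b) topology" where
  "compact_open_topology K Y =
     topology_generated_by
       {{\<gamma> \<in> mapping_space_carrier K Y. \<gamma> ` C \<subseteq> U} | C U. compactin K C \<and> openin Y U}"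

definition path_space :: "'y topology \<Rightarrow> (real \<Rightarrow> 'y) topology" where
  "path_space Y = compact_open_topology (top_of_set {0..1}) Y"

definition based_path_space :: "'y topology \<Rightarrow> 'y \<Rightarrow> (real \<Rightarrow> 'y) topology" where
  "based_path_space Y y0 = subtopology (path_space Y) {\<gamma>. \<gamma> 1 = y0}"

text \<open>
  The total space of the pullback of \<open>p : E \<rightarrow> Z\<close> along \<open>g : X \<rightarrow> Z\<close>; the pulled back map to \<open>X\<close>
  is \<^term>\<open>fst\<close>.
\<close>

definition pullback :: "'x topology \<Rightarrow> 'e topology \<Rightarrow> ('x \<Rightarrow> 'z) \<Rightarrow> ('e \<Rightarrow> 'z) \<Rightarrow> ('x \<times> 'e) topology" where
  "pullback X E g p = subtopology (prod_topology X E) {(x, e). g x = p e}"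

text \<open>
  The power \<open>X\<^sup>m\<close> is the product over the index set \<open>{..<m}\<close>, so coordinates, times
  and families of maps are numbered from \<open>0\<close>.
\<close>

definition power_topology :: "nat \<Rightarrow> 'x topology \<Rightarrow> (nat \<Rightarrow> 'x) topology" where
  "power_topology m X = product_topology (\<lambda>_. X) {..<m}"

definition power_map :: "nat \<Rightarrow> ('x \<Rightarrow> 'y) \<Rightarrow> (nat \<Rightarrow> 'x) \<Rightarrow> (nat \<Rightarrow> 'y)" where
  "power_map m f x = (\<lambda>i\<in>{..<m}. f (x i))"

definition tuple_map :: "('x \<Rightarrow> 'y) list \<Rightarrow> 'x \<Rightarrow> (nat \<Rightarrow> 'y)" where
  "tuple_map gs x = (\<lambda>i\<in>{..<length gs}. (gs ! i) x)"

definition time_partition :: "nat \<Rightarrow> real list \<Rightarrow> bool" where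
  "time_partition m ts \<longleftrightarrow>
     length ts = m \<and> hd ts = 0 \<and> last ts = 1 \<and> sorted_wrt (<) ts"

definition path_eval :: "real list \<Rightarrow> (real \<Rightarrow> 'y) \<Rightarrow> (nat \<Rightarrow> 'y)" where
  "path_eval ts \<gamma> = (\<lambda>i\<in>{..<length ts}. \<gamma> (ts ! i))"


section \<open>Sectional category\<close>

text \<open>The infimum in \<^typ>\<open>enat\<close> is the least such number, and \<open>\<infinity>\<close> if there is none.\<close>

definition secat :: "'e topology \<Rightarrow> 'b topology \<Rightarrow> ('e \<Rightarrow> 'b) \<Rightarrow> enat" where
  "secat E B p = Inf {enat n | n. \<exists>U :: nat \<Rightarrow> 'b set.
     (\<forall>j\<le>n. openin B (U j)) \<and> topspace B = (\<Union>j\<le>n. U j) \<and>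
     (\<forall>j\<le>n. \<exists>s. continuous_map (subtopology B (U j)) E s \<and> (\<forall>b\<in>U j. p (s b) = b))}"


section \<open>Finitely supported probability measures\<close>

definition finite_prob :: "nat \<Rightarrow> 'e topology \<Rightarrow> 'e pmf set" where
  "finite_prob k E =
     {\<mu>. finite (set_pmf \<mu>) \<and> card (set_pmf \<mu>) \<le> k \<and> set_pmf \<mu> \<subseteq> topspace E}"

subsection \<open>The quotient topology from the symmetric join\<close>

definition quotient_topology :: "'a topology \<Rightarrow> ('a \<Rightarrow> 'b) \<Rightarrow> 'b topology" where
  "quotient_topology X f =
     topology (\<lambda>U. U \<subseteq> f ` topspace X \<and> openin X {x \<in> topspace X. f x \<in> U})"

lemma openin_quotient_topology:
  "openin (quotient_topology X f) U \<longleftrightarrow>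
     U \<subseteq> f ` topspace X \<and> openin X {x \<in> topspace X. f x \<in> U}"
proof -
  have "istopology (\<lambda>U. U \<subseteq> f ` topspace X \<and> openin X {x \<in> topspace X. f x \<in> U})"
    unfolding istopology_def
  proof (intro conjI allI impI)
    fix S T
    assume S: "S \<subseteq> f ` topspace X \<and> openin X {x \<in> topspace X. f x \<in> S}"
      and T: "T \<subseteq> f ` topspace X \<and> openin X {x \<in> topspace X. f x \<in> T}"
    have "{x \<in> topspace X. f x \<in> S \<inter> T} =
            {x \<in> topspace X. f x \<in> S} \<inter> {x \<in> topspace X. f x \<in> T}"
      by blast
    then show "openin X {x \<in> topspace X. f x \<in> S \<inter> T}"
      using S T by auto
    show "S \<inter> T \<subseteq> f ` topspace X" using S by blast
  next
    fix \<K>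
    assume K: "\<forall>K\<in>\<K>. K \<subseteq> f ` topspace X \<and> openin X {x \<in> topspace X. f x \<in> K}"
    have "{x \<in> topspace X. f x \<in> \<Union>\<K>} = \<Union>((\<lambda>K. {x \<in> topspace X. f x \<in> K}) ` \<K>)"
      by blast
    then show "openin X {x \<in> topspace X. f x \<in> \<Union>\<K>}"
      using K by auto
    show "\<Union>\<K> \<subseteq> f ` topspace X" using K by blast
  qed
  then show ?thesis
    unfolding quotient_topology_def by (simp add: topology_inverse')
qed

lemma quotient_map_quotient_topology: "quotient_map X (quotient_topology X f) f"
proof -
  have "{x \<in> topspace X. f x \<in> f ` topspace X} = topspace X" by blast
  then have "openin (quotient_topology X f) (f ` topspace X)"
    by (simp add: openin_quotient_topology)
  then have "topspace (quotient_topology X f) = f ` topspace X"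
    by (metis openin_quotient_topology openin_subset openin_topspace subset_antisym)
  then show ?thesis
    by (auto simp: quotient_map_def openin_quotient_topology)
qed

text \<open>
  The space \<open>\<B>\<^sub>k(E)\<close> with the topology coming from the symmetric join, for \<open>k \<ge> 1\<close>.  Weights
  \<open>w\<close> range over the standard simplex with vertices \<open>0, \<dots>, k - 1\<close>, and \<open>(w, e)\<close> is sent to the
  measure \<open>\<Sum>i<k. w i e\<^sub>i\<close>.  Since quotient maps compose, passing in one step from
  \<open>\<Delta>\<^bsup>k-1\<^esup> \<times> E\<^sup>k\<close> to measures gives the same topology as passing through the join \<open>\<ast>\<^sup>kE\<close> and its
  orbit space under the symmetric group.
\<close>

definition sym_join_topology :: "nat \<Rightarrow> 'e topology \<Rightarrow> 'e pmf topology" where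
  "sym_join_topology k E =
     quotient_topology
       (prod_topology (subtopology (powertop_real UNIV) (standard_simplex (k - 1)))
                      (power_topology k E))
       (\<lambda>(w, e). map_pmf e (embed_pmf w))"

subsection \<open>The Levy-Prokhorov topology\<close>

definition thickening :: "'e topology \<Rightarrow> ('e \<Rightarrow> 'e \<Rightarrow> real) \<Rightarrow> real \<Rightarrow> 'e set \<Rightarrow> 'e set" where
  "thickening E d \<epsilon> A = {y \<in> topspace E. \<exists>x\<in>A. d x y < \<epsilon>}"

definition borel_sets_of :: "'e topology \<Rightarrow> 'e set set" where
  "borel_sets_of E = sigma_sets (topspace E) {U. openin E U}"

definition levy_prokhorov ::
    "'e topology \<Rightarrow> ('e \<Rightarrow> 'e \<Rightarrow> real) \<Rightarrow> 'e pmf \<Rightarrow> 'e pmf \<Rightarrow> real" where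
  "levy_prokhorov E d \<mu> \<nu> = Inf {\<epsilon>. \<epsilon> > 0 \<and> (\<forall>A \<in> borel_sets_of E.
     measure_pmf.prob \<mu> A \<le> measure_pmf.prob \<nu> (thickening E d \<epsilon> A) + \<epsilon> \<and>
     measure_pmf.prob \<nu> A \<le> measure_pmf.prob \<mu> (thickening E d \<epsilon> A) + \<epsilon>)}"

definition compatible_metric :: "('e \<Rightarrow> 'e \<Rightarrow> real) \<Rightarrow> 'e topology \<Rightarrow> bool" where
  "compatible_metric d E \<longleftrightarrow>
     Metric_space (topspace E) d \<and> Metric_space.mtopology (topspace E) d = E"

lemma metric_space_levy_prokhorov:
  assumes d: "compatible_metric d E"
  shows "Metric_space (finite_prob k E) (levy_prokhorov E d)"
proof -
  interpret E: Metric_space "topspace E" d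
    using d by (simp add: compatible_metric_def)
  have E: "E.mtopology = E"
    using d by (simp add: compatible_metric_def)
  define adm where "adm \<mu> \<nu> \<epsilon> \<longleftrightarrow> \<epsilon> > 0 \<and> (\<forall>A \<in> borel_sets_of E.
     measure_pmf.prob \<mu> A \<le> measure_pmf.prob \<nu> (thickening E d \<epsilon> A) + \<epsilon> \<and>
     measure_pmf.prob \<nu> A \<le> measure_pmf.prob \<mu> (thickening E d \<epsilon> A) + \<epsilon>)" for \<mu> \<nu> \<epsilon>
  have lp: "levy_prokhorov E d \<mu> \<nu> = Inf {\<epsilon>. adm \<mu> \<nu> \<epsilon>}" for \<mu> \<nu>
    by (simp add: levy_prokhorov_def adm_def)
  have adm1: "adm \<mu> \<nu> 1" for \<mu> \<nu>
  proof -
    have "measure_pmf.prob p A \<le> measure_pmf.prob q B + 1" for p q :: "'a pmf" and A B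
      using measure_pmf.prob_le_1[of p A] measure_nonneg[of q B] by linarith
    then show ?thesis by (simp add: adm_def)
  qed
  have ne: "{\<epsilon>. adm \<mu> \<nu> \<epsilon>} \<noteq> {}" for \<mu> \<nu>
    using adm1 by blast
  have bdd: "bdd_below {\<epsilon>. adm \<mu> \<nu> \<epsilon>}" for \<mu> \<nu>
    by (rule bdd_belowI[of _ 0]) (auto simp: adm_def)
  have sym: "adm \<mu> \<nu> \<epsilon> \<longleftrightarrow> adm \<nu> \<mu> \<epsilon>" for \<mu> \<nu> \<epsilon>
    by (auto simp: adm_def)
  have lp_sym: "levy_prokhorov E d \<mu> \<nu> = levy_prokhorov E d \<nu> \<mu>" for \<mu> \<nu>
    unfolding lp by (rule arg_cong[where f = Inf]) (use sym in auto)
  have small: "\<exists>\<epsilon><r. adm \<mu> \<nu> \<epsilon>" if "levy_prokhorov E d \<mu> \<nu> < r" for \<mu> \<nu> r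
    using that ne bdd by (auto simp: lp cInf_less_iff)
  have open_thick: "openin E (thickening E d \<epsilon> A)" if "A \<subseteq> topspace E" for \<epsilon> A
  proof -
    have "thickening E d \<epsilon> A = (\<Union>x\<in>A. E.mball x \<epsilon>)"
      using that by (auto simp: thickening_def subset_iff)
    moreover have "openin E.mtopology (\<Union>x\<in>A. E.mball x \<epsilon>)"
      by blast
    ultimately show ?thesis by (simp add: E)
  qed
  have borel_sub: "A \<subseteq> topspace E" if "A \<in> borel_sets_of E" for A
    using that sigma_sets_into_sp[of "{U. openin E U}" "topspace E" A]
    by (auto simp: borel_sets_of_def dest: openin_subset)
  have thick_borel: "thickening E d \<epsilon> A \<in> borel_sets_of E" if "A \<in> borel_sets_of E" for \<epsilon> A
    using open_thick[OF borel_sub[OF that]] by (auto simp: borel_sets_of_def)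
  have single_borel: "{x} \<in> borel_sets_of E" if "x \<in> topspace E" for x
  proof -
    have "closedin E {x}"
      using that E.Hausdorff_space_mtopology E by (simp add: closedin_Hausdorff_singleton)
    then have "openin E (topspace E - {x})" by blast
    then have "topspace E - (topspace E - {x}) \<in> borel_sets_of E"
      unfolding borel_sets_of_def by (intro sigma_sets.Compl sigma_sets.Basic) auto
    moreover have "topspace E - (topspace E - {x}) = {x}" using that by blast
    ultimately show ?thesis by simp
  qed
  have adm_trans: "adm \<mu> \<rho> (\<epsilon> + \<delta>)" 
    if \<mu>\<nu>: "adm \<mu> \<nu> \<epsilon>" and \<nu>\<rho>: "adm \<nu> \<rho> \<delta>" for \<mu> \<nu> \<rho> \<epsilon> \<delta>
  proof -
    have thick: "thickening E d r (thickening E d r' A) \<subseteq> thickening E d (\<epsilon> + \<delta>) A"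
      if "A \<in> borel_sets_of E" "r + r' = \<epsilon> + \<delta>" for r r' A
    proof
      fix y assume "y \<in> thickening E d r (thickening E d r' A)"
      then obtain x z where y: "y \<in> topspace E" "x \<in> topspace E" "z \<in> A" "d x y < r" "d z x < r'"
        by (auto simp: thickening_def)
      then have "d z y < \<epsilon> + \<delta>"
        using E.triangle[of z x y] borel_sub[OF that(1)] that(2) by force
      then show "y \<in> thickening E d (\<epsilon> + \<delta>) A"
        using y by (auto simp: thickening_def)
    qed
    have *: "measure_pmf.prob p A \<le> measure_pmf.prob q (thickening E d (\<epsilon> + \<delta>) A) + (\<epsilon> + \<delta>)"
      if A: "A \<in> borel_sets_of E" and r: "r + r' = \<epsilon> + \<delta>" and pq: "adm p u r" "adm u q r'"
      for p q u r r' A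
    proof -
      have "measure_pmf.prob p A \<le> measure_pmf.prob u (thickening E d r A) + r"
        using pq(1) A by (simp add: adm_def)
      also have "measure_pmf.prob u (thickening E d r A)
          \<le> measure_pmf.prob q (thickening E d r' (thickening E d r A)) + r'"
        using pq(2) thick_borel[OF A] by (simp add: adm_def)
      also have "measure_pmf.prob q (thickening E d r' (thickening E d r A))
          \<le> measure_pmf.prob q (thickening E d (\<epsilon> + \<delta>) A)"
        using thick[OF A, of r' r] r by (intro measure_pmf.finite_measure_mono) auto
      finally show ?thesis using r by simp
    qed
    have "\<epsilon> + \<delta> > 0"
      using \<mu>\<nu> \<nu>\<rho> by (simp add: adm_def)
    moreover have "adm \<rho> \<nu> \<delta>" "adm \<nu> \<mu> \<epsilon>"
      using \<mu>\<nu> \<nu>\<rho> sym by auto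
    ultimately show ?thesis
      unfolding adm_def[of \<mu> \<rho>]
      using *[OF _ refl \<mu>\<nu> \<nu>\<rho>] *[OF _ add.commute, of _ \<rho> \<nu> \<mu>] by auto
  qed
  show ?thesis
  proof (rule Metric_space.intro)
    fix \<mu> \<nu> :: "'a pmf"
    show "0 \<le> levy_prokhorov E d \<mu> \<nu>"
      unfolding lp using ne by (intro cInf_greatest) (auto simp: adm_def)
    show "levy_prokhorov E d \<mu> \<nu> = levy_prokhorov E d \<nu> \<mu>"
      by (rule lp_sym)
  next
    fix \<mu> \<nu> :: "'a pmf"
    assume \<mu>: "\<mu> \<in> finite_prob k E" and \<nu>: "\<nu> \<in> finite_prob k E"
    have le: "pmf p x \<le> pmf q x"
      if q: "q \<in> finite_prob k E" and x: "x \<in> topspace E" and lp0: "levy_prokhorov E d p q = 0"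
      for p q x
    proof (rule field_le_epsilon)
      fix e :: real assume "e > 0"
      have fin: "finite (insert e (d x ` (set_pmf q - {x})))"
        using q by (simp add: finite_prob_def)
      define r where "r = Min (insert e (d x ` (set_pmf q - {x})))"
      have "\<forall>t \<in> insert e (d x ` (set_pmf q - {x})). t > 0"
        using \<open>e > 0\<close> q x E.mdist_pos_less by (auto simp: finite_prob_def)
      then have "r > 0" unfolding r_def using fin by (subst Min_gr_iff) auto
      then obtain \<epsilon> where \<epsilon>: "\<epsilon> < r" "adm p q \<epsilon>" using small lp0 by metis
      have "\<epsilon> < e" using \<epsilon>(1) fin by (simp add: r_def)
      have "thickening E d \<epsilon> {x} \<inter> set_pmf q \<subseteq> {x}"
      proof
        fix y assume y: "y \<in> thickening E d \<epsilon> {x} \<inter> set_pmf q"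
        show "y \<in> {x}"
        proof (rule ccontr)
          assume "y \<notin> {x}"
          then have "r \<le> d x y" unfolding r_def using y by (intro Min_le fin) auto
          then show False using y \<epsilon>(1) by (simp add: thickening_def)
        qed
      qed
      then have "measure_pmf.prob q (thickening E d \<epsilon> {x} \<inter> set_pmf q) \<le> measure_pmf.prob q {x}"
        by (intro measure_pmf.finite_measure_mono) auto
      then have "measure_pmf.prob q (thickening E d \<epsilon> {x}) \<le> pmf q x"
        by (simp add: measure_Int_set_pmf measure_pmf_single)
      moreover have "measure_pmf.prob p {x} \<le> measure_pmf.prob q (thickening E d \<epsilon> {x}) + \<epsilon>"
        using \<epsilon>(2) single_borel[OF x] by (simp add: adm_def)
      ultimately show "pmf p x \<le> pmf q x + e"
        using \<open>\<epsilon> < e\<close> by (simp add: measure_pmf_single)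
    qed
    show "levy_prokhorov E d \<mu> \<nu> = 0 \<longleftrightarrow> \<mu> = \<nu>"
    proof
      assume lp0: "levy_prokhorov E d \<mu> \<nu> = 0"
      then have lp1: "levy_prokhorov E d \<nu> \<mu> = 0"
        using lp_sym[of \<mu> \<nu>] by simp
      show "\<mu> = \<nu>"
      proof (rule pmf_eqI)
        fix x
        show "pmf \<mu> x = pmf \<nu> x"
        proof (cases "x \<in> topspace E")
          case True
          then show ?thesis using le[OF \<nu> True lp0] le[OF \<mu> True lp1] by simp
        next
          case False
          then have "x \<notin> set_pmf \<mu>" "x \<notin> set_pmf \<nu>"
            using \<mu> \<nu> by (auto simp: finite_prob_def)
          then show ?thesis by (simp add: set_pmf_iff)
        qed
      qed
    next
      assume eq: "\<mu> = \<nu>"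
      have "adm \<mu> \<mu> \<epsilon>" if "\<epsilon> > 0" for \<epsilon>
      proof -
        have "measure_pmf.prob \<mu> A \<le> measure_pmf.prob \<mu> (thickening E d \<epsilon> A) + \<epsilon>"
          if A: "A \<in> borel_sets_of E" for A
        proof -
          have "A \<subseteq> thickening E d \<epsilon> A"
            using borel_sub[OF A] \<open>\<epsilon> > 0\<close> by (force simp: thickening_def)
          then have "measure_pmf.prob \<mu> A \<le> measure_pmf.prob \<mu> (thickening E d \<epsilon> A)"
            by (intro measure_pmf.finite_measure_mono) auto
          then show ?thesis using \<open>\<epsilon> > 0\<close> by simp
        qed
        then show ?thesis using that by (simp add: adm_def)
      qed
      then have "{\<epsilon>. adm \<mu> \<mu> \<epsilon>} = {0<..}"
        by (auto simp: adm_def)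
      then show "levy_prokhorov E d \<mu> \<nu> = 0"
        by (simp add: lp eq[symmetric])
    qed
  next
    fix \<mu> \<nu> \<rho> :: "'a pmf"
    show "levy_prokhorov E d \<mu> \<rho> \<le> levy_prokhorov E d \<mu> \<nu> + levy_prokhorov E d \<nu> \<rho>"
    proof (rule field_le_epsilon)
      fix e :: real assume "e > 0"
      obtain \<epsilon> where \<epsilon>: "\<epsilon> < levy_prokhorov E d \<mu> \<nu> + e / 2" "adm \<mu> \<nu> \<epsilon>"
        using small[of \<mu> \<nu> "levy_prokhorov E d \<mu> \<nu> + e / 2"] \<open>e > 0\<close> by auto
      obtain \<delta> where \<delta>: "\<delta> < levy_prokhorov E d \<nu> \<rho> + e / 2" "adm \<nu> \<rho> \<delta>"
        using small[of \<nu> \<rho> "levy_prokhorov E d \<nu> \<rho> + e / 2"] \<open>e > 0\<close> by auto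
      have "levy_prokhorov E d \<mu> \<rho> \<le> \<epsilon> + \<delta>"
        unfolding lp using adm_trans[OF \<epsilon>(2) \<delta>(2)] bdd by (intro cInf_lower) auto
      then show "levy_prokhorov E d \<mu> \<rho>
          \<le> levy_prokhorov E d \<mu> \<nu> + levy_prokhorov E d \<nu> \<rho> + e"
        using \<epsilon>(1) \<delta>(1) by linarith
    qed
  qed
qed

text \<open>
  The metric \<open>d\<close> is a parameter: results about metrizable \<open>E\<close> are stated for all metrics compatible
  with the topology of \<open>E\<close>.
\<close>

definition levy_prokhorov_topology ::
    "('e \<Rightarrow> 'e \<Rightarrow> real) \<Rightarrow> nat \<Rightarrow> 'e topology \<Rightarrow> 'e pmf topology" where
  "levy_prokhorov_topology d k E =
     Metric_space.mtopology (finite_prob k E) (levy_prokhorov E d)"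


section \<open>Distributional sectional category\<close>

text \<open>
  Below, \<open>\<T> k E\<close> is the chosen topology on the set \<open>\<B>\<^sub>k(E)\<close> of probability measures with at most \<open>k\<close>
  support points; it is instantiated with \<^term>\<open>sym_join_topology\<close> or
  \<^term>\<open>levy_prokhorov_topology d\<close>.
\<close>

definition fiber_prob ::
    "(nat \<Rightarrow> 'e topology \<Rightarrow> 'e pmf topology) \<Rightarrow> nat \<Rightarrow> 'e topology \<Rightarrow> 'b topology \<Rightarrow> ('e \<Rightarrow> 'b)
       \<Rightarrow> 'e pmf topology" where
  "fiber_prob \<T> k E B p =
     subtopology (\<T> k E) {\<mu>. \<exists>b\<in>topspace B. \<forall>e\<in>set_pmf \<mu>. p e = b}"

definition fiber_proj :: "('e \<Rightarrow> 'b) \<Rightarrow> 'e pmf \<Rightarrow> 'b" where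
  "fiber_proj p \<mu> = the_elem (p ` set_pmf \<mu>)"

definition dsecat ::
    "(nat \<Rightarrow> 'e topology \<Rightarrow> 'e pmf topology) \<Rightarrow> 'e topology \<Rightarrow> 'b topology \<Rightarrow> ('e \<Rightarrow> 'b) \<Rightarrow> enat" where
  "dsecat \<T> E B p = Inf {enat n | n.
     \<exists>s. continuous_map B (fiber_prob \<T> (n + 1) E B p) s \<and>
         (\<forall>b\<in>topspace B. fiber_proj p (s b) = b)}"


section \<open>Homotopic distance, category and topological complexity of maps\<close>

definition homotopic_distance :: "'x topology \<Rightarrow> 'y topology \<Rightarrow> ('x \<Rightarrow> 'y) list \<Rightarrow> enat" where
  "homotopic_distance X Y gs = Inf {enat n | n. \<exists>U :: nat \<Rightarrow> 'x set.
     (\<forall>j\<le>n. openin X (U j)) \<and> topspace X = (\<Union>j\<le>n. U j) \<and>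
     (\<forall>j\<le>n. \<forall>g\<in>set gs. \<forall>h\<in>set gs.
        homotopic_with (\<lambda>_. True) (subtopology X (U j)) Y g h)}"

definition distance_space ::
    "real list \<Rightarrow> 'x topology \<Rightarrow> 'y topology \<Rightarrow> ('x \<Rightarrow> 'y) list \<Rightarrow> ('x \<times> (real \<Rightarrow> 'y)) topology" where
  "distance_space ts X Y gs = pullback X (path_space Y) (tuple_map gs) (path_eval ts)"

definition dhomotopic_distance where
  "dhomotopic_distance \<T> ts X Y gs = dsecat \<T> (distance_space ts X Y gs) X fst"

definition cat_space ::
    "'x topology \<Rightarrow> 'y topology \<Rightarrow> 'y \<Rightarrow> ('x \<Rightarrow> 'y) \<Rightarrow> ('x \<times> (real \<Rightarrow> 'y)) topology" where
  "cat_space X Y y0 f = pullback X (based_path_space Y y0) f (\<lambda>\<gamma>. \<gamma> 0)"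

definition cat_map :: "'x topology \<Rightarrow> 'y topology \<Rightarrow> 'y \<Rightarrow> ('x \<Rightarrow> 'y) \<Rightarrow> enat" where
  "cat_map X Y y0 f = secat (cat_space X Y y0 f) X fst"

definition dcat_map where
  "dcat_map \<T> X Y y0 f = dsecat \<T> (cat_space X Y y0 f) X fst"

definition TC_space ::
    "nat \<Rightarrow> real list \<Rightarrow> 'x topology \<Rightarrow> 'y topology \<Rightarrow> ('x \<Rightarrow> 'y)
       \<Rightarrow> ((nat \<Rightarrow> 'x) \<times> (real \<Rightarrow> 'y)) topology" where
  "TC_space m ts X Y f =
     pullback (power_topology m X) (path_space Y) (power_map m f) (path_eval ts)"

definition TC_map :: "nat \<Rightarrow> real list \<Rightarrow> 'x topology \<Rightarrow> 'y topology \<Rightarrow> ('x \<Rightarrow> 'y) \<Rightarrow> enat" where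
  "TC_map m ts X Y f = secat (TC_space m ts X Y f) (power_topology m X) fst"

definition dTC_map where
  "dTC_map \<T> m ts X Y f = dsecat \<T> (TC_space m ts X Y f) (power_topology m X) fst"

definition pr :: "nat \<Rightarrow> (nat \<Rightarrow> 'x) \<Rightarrow> 'x" where
  "pr i x = x i"

end

theory Submission
  imports Defs
begin

text \<open>
  The total space defining the category of \<open>f\<close> is a space of pairs \<open>(x, \<gamma>)\<close> with \<open>\<gamma>\<close> a path from
  \<open>f x\<close> to the basepoint, and the one defining topological complexity consists of tuples \<open>x\<close> with
  a path visiting \<open>f (x\<^sub>1), \<dots>, f (x\<^sub>m)\<close> at the prescribed times.  Both coincide, as topological
  spaces over the base, with the space of pairs that defines the homotopic distance of
  \<open>(f, \<ast>)\<close>, respectively of the maps \<open>f \<circ> pr\<^sub>i\<close>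
  (\<open>cat_space_eq_distance_space\<close>, \<open>TC_space_eq_distance_space\<close>).

  For the classical invariants it remains to see that the homotopic distance, defined by
  homotopies, is a sectional category (\<open>secat_distance_space\<close>).  By the exponential law for the
  compact interval, a partial section over \<open>U\<close> is a map \<open>I \<times> U \<rightarrow> Y\<close> restricting to \<open>g\<^sub>i\<close> at time
  \<open>t\<^sub>i\<close>; such a map exists exactly when the restrictions of the \<open>g\<^sub>i\<close> to \<open>U\<close> are mutually homotopic.

  For the distributional invariants, exchanging \<open>f\<close> and \<open>\<ast>\<close> amounts to reversing paths, a
  fibrewise homeomorphism.  A continuous map pushes measures forward continuously, both for the
  quotient topology and for the Levy-Prokhorov metrics
  (\<open>continuous_map_push_sym_join\<close>, \<open>continuous_map_push_levy_prokhorov\<close>), so a fibrewise map carries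
  sections by measures to sections by measures.  Applied to the identity map, this also shows that
  the Levy-Prokhorov version does not depend on the compatible metric, which is what makes the
  comparison meaningful when the two sides are computed with unrelated metrics.
\<close>

section \<open>The exponential law for the compact-open topology\<close>

lemma topspace_compact_open_topology: "topspace (compact_open_topology K Y) = mapping_space_carrier K Y"
proof -
  have "{\<gamma> \<in> mapping_space_carrier K Y. \<gamma> ` {} \<subseteq> {}} = mapping_space_carrier K Y"
    by simp
  then have "mapping_space_carrier K Y \<in>
      {{\<gamma> \<in> mapping_space_carrier K Y. \<gamma> ` C \<subseteq> U} | C U. compactin K C \<and> openin Y U}"
    by (intro CollectI exI[of _ "{}"] conjI) auto
  then show ?thesis
    unfolding compact_open_topology_def topology_generated_by_topspace by blast
qed

lemma continuous_map_into_compact_open_topology: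
  assumes "s \<in> topspace X \<rightarrow> mapping_space_carrier K Y"
    and "\<And>C U. compactin K C \<Longrightarrow> openin Y U \<Longrightarrow> openin X {x \<in> topspace X. s x ` C \<subseteq> U}"
  shows "continuous_map X (compact_open_topology K Y) s"
  unfolding compact_open_topology_def
proof (rule continuous_on_generated_topo)
  fix W assume "W \<in> {{\<gamma> \<in> mapping_space_carrier K Y. \<gamma> ` C \<subseteq> U} | C U. compactin K C \<and> openin Y U}"
  then obtain C U where W: "W = {\<gamma> \<in> mapping_space_carrier K Y. \<gamma> ` C \<subseteq> U}"
    and CU: "compactin K C" "openin Y U"
    by blast
  have "s -` W \<inter> topspace X = {x \<in> topspace X. s x ` C \<subseteq> U}"
    using assms(1) by (auto simp: W)
  then show "openin X (s -` W \<inter> topspace X)"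
    using assms(2)[OF CU] by simp
next
  show "s ` topspace X \<subseteq> \<Union> {{\<gamma> \<in> mapping_space_carrier K Y. \<gamma> ` C \<subseteq> U} | C U.
      compactin K C \<and> openin Y U}"
    using assms(1) topspace_compact_open_topology[of K Y]
    unfolding compact_open_topology_def topology_generated_by_topspace by blast
qed

lemma openin_compact_open_subbasis:
  assumes "compactin K C" "openin Y U"
  shows "openin (compact_open_topology K Y) {\<gamma> \<in> mapping_space_carrier K Y. \<gamma> ` C \<subseteq> U}"
  unfolding compact_open_topology_def using assms by (intro topology_generated_by_Basis) blast

text \<open>
  The tube lemma turns the condition that a whole compact set is sent into \<open>U\<close> into an open
  condition on the parameter \<open>x\<close>.
\<close>

lemma continuous_map_curry:
  assumes H: "continuous_map (prod_topology K X) Y H"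
  shows "continuous_map X (compact_open_topology K Y) (\<lambda>x. \<lambda>t\<in>topspace K. H (t, x))"
proof (rule continuous_map_into_compact_open_topology)
  show "(\<lambda>x. \<lambda>t\<in>topspace K. H (t, x)) \<in> topspace X \<rightarrow> mapping_space_carrier K Y"
  proof
    fix x assume "x \<in> topspace X"
    then have "continuous_map K (prod_topology K X) (\<lambda>t. (t, x))"
      by (simp add: continuous_map_pairedI)
    then have "continuous_map K Y (\<lambda>t. H (t, x))"
      using continuous_map_compose[OF _ H] by (fastforce simp: o_def)
    then have "continuous_map K Y (\<lambda>t\<in>topspace K. H (t, x))"
      by (rule continuous_map_eq) simp
    then show "(\<lambda>t\<in>topspace K. H (t, x)) \<in> mapping_space_carrier K Y"
      by (simp add: mapping_space_carrier_def)
  qed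
next
  fix C U assume C: "compactin K C" and U: "openin Y U"
  define W where "W = {z \<in> topspace (prod_topology K X). H z \<in> U}"
  have W: "openin (prod_topology K X) W"
    unfolding W_def by (rule openin_continuous_map_preimage[OF H U])
  have CK: "C \<subseteq> topspace K"
    by (rule compactin_subset_topspace[OF C])
  show "openin X {x \<in> topspace X. (\<lambda>t\<in>topspace K. H (t, x)) ` C \<subseteq> U}" (is "openin X ?S")
  proof (subst openin_subopen, intro ballI)
    fix x assume x: "x \<in> ?S"
    then have "C \<times> {x} \<subseteq> W"
      using CK by (force simp: W_def)
    then obtain A V where "openin X V" "C \<subseteq> A" "x \<in> V" "A \<times> V \<subseteq> W"
      using tube_lemma_left[OF W C, of x] x by auto
    moreover from this have "V \<subseteq> ?S"
      using CK openin_subset[of X V] by (fastforce simp: W_def)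
    ultimately show "\<exists>T. openin X T \<and> x \<in> T \<and> T \<subseteq> ?S"
      by blast
  qed
qed

text \<open>
  Local compactness of \<open>K\<close> supplies, around each \<open>t\<close>, a compact neighbourhood on which the map
  stays in a given open set; this makes evaluation jointly continuous.
\<close>

lemma continuous_map_uncurry:
  assumes K: "locally_compact_space K" "Hausdorff_space K"
    and s: "continuous_map X (compact_open_topology K Y) s"
  shows "continuous_map (prod_topology K X) Y (\<lambda>(t, x). s x t)"
  unfolding continuous_map_def
proof (intro conjI allI impI)
  have sx: "s x \<in> mapping_space_carrier K Y" if "x \<in> topspace X" for x
    using continuous_map_image_subset_topspace[OF s] that topspace_compact_open_topology by blast
  then have cont: "continuous_map K Y (s x)" if "x \<in> topspace X" for x
    using that by (simp add: mapping_space_carrier_def)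
  show "(\<lambda>(t, x). s x t) \<in> topspace (prod_topology K X) \<rightarrow> topspace Y"
    using cont by (auto simp: continuous_map_def)
  fix U assume U: "openin Y U"
  show "openin (prod_topology K X)
      {z \<in> topspace (prod_topology K X). (case z of (t, x) \<Rightarrow> s x t) \<in> U}" (is "openin _ ?S")
    unfolding openin_prod_topology_alt
  proof (intro allI impI)
    fix t x assume "(t, x) \<in> ?S"
    then have t: "t \<in> topspace K" and x: "x \<in> topspace X" and stx: "s x t \<in> U"
      by auto
    have "openin K {t \<in> topspace K. s x t \<in> U}"
      by (rule openin_continuous_map_preimage[OF cont[OF x] U])
    moreover have "neighbourhood_base_of (compactin K) K"
      using K locally_compact_imp_neighbourhood_base locally_compact_Hausdorff_imp_regular_space
      by blast
    ultimately obtain N C where N: "openin K N" and C: "compactin K C"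
      and NC: "t \<in> N" "N \<subseteq> C" "C \<subseteq> {t \<in> topspace K. s x t \<in> U}"
      unfolding neighbourhood_base_of using t stx by (metis (mono_tags, lifting) mem_Collect_eq)
    define V where "V = {x' \<in> topspace X. s x' \<in> {\<gamma> \<in> mapping_space_carrier K Y. \<gamma> ` C \<subseteq> U}}"
    have "openin X V"
      unfolding V_def
      by (rule openin_continuous_map_preimage[OF s openin_compact_open_subbasis[OF C U]])
    moreover have "x \<in> V"
      using NC x sx[OF x] by (auto simp: V_def)
    moreover have "N \<times> V \<subseteq> ?S"
      using NC(2) openin_subset[OF N] by (auto simp: V_def)
    ultimately show "\<exists>A B. openin K A \<and> openin X B \<and> t \<in> A \<and> x \<in> B \<and> A \<times> B \<subseteq> ?S"
      using N NC(1) by blast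
  qed
qed

lemma continuous_map_precompose:
  assumes r: "continuous_map K L r"
  shows "continuous_map (compact_open_topology L Y) (compact_open_topology K Y)
           (\<lambda>\<gamma>. \<lambda>t\<in>topspace K. \<gamma> (r t))"
proof (rule continuous_map_into_compact_open_topology)
  show "(\<lambda>\<gamma>. \<lambda>t\<in>topspace K. \<gamma> (r t)) \<in>
      topspace (compact_open_topology L Y) \<rightarrow> mapping_space_carrier K Y"
  proof
    fix \<gamma> assume "\<gamma> \<in> topspace (compact_open_topology L Y)"
    then have "continuous_map L Y \<gamma>"
      by (simp add: topspace_compact_open_topology mapping_space_carrier_def)
    then have "continuous_map K Y (\<gamma> \<circ> r)"
      using continuous_map_compose[OF r] by blast
    then have "continuous_map K Y (\<lambda>t\<in>topspace K. \<gamma> (r t))"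
      by (rule continuous_map_eq) simp
    then show "(\<lambda>t\<in>topspace K. \<gamma> (r t)) \<in> mapping_space_carrier K Y"
      by (simp add: mapping_space_carrier_def)
  qed
next
  fix C U assume C: "compactin K C" and U: "openin Y U"
  have "{\<gamma> \<in> topspace (compact_open_topology L Y). (\<lambda>t\<in>topspace K. \<gamma> (r t)) ` C \<subseteq> U} =
      {\<gamma> \<in> mapping_space_carrier L Y. \<gamma> ` (r ` C) \<subseteq> U}"
    using compactin_subset_topspace[OF C] by (fastforce simp: topspace_compact_open_topology)
  then show "openin (compact_open_topology L Y)
      {\<gamma> \<in> topspace (compact_open_topology L Y). (\<lambda>t\<in>topspace K. \<gamma> (r t)) ` C \<subseteq> U}"
    using openin_compact_open_subbasis[OF image_compactin[OF C r] U] by simp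
qed


section \<open>Partial sections and homotopies\<close>

lemma tuple_map_eq_path_eval_iff:
  assumes "length gs = length ts"
  shows "tuple_map gs x = path_eval ts \<gamma> \<longleftrightarrow> (\<forall>i<length ts. (gs ! i) x = \<gamma> (ts ! i))"
  unfolding tuple_map_def path_eval_def assms
  by (simp add: fun_eq_iff restrict_def)

lemma topspace_distance_space:
  assumes "length gs = length ts"
  shows "topspace (distance_space ts X Y gs) =
    {(x, \<gamma>). x \<in> topspace X \<and> \<gamma> \<in> mapping_space_carrier (top_of_set {0..1}) Y \<and>
       (\<forall>i<length ts. (gs ! i) x = \<gamma> (ts ! i))}"
  by (auto simp: tuple_map_eq_path_eval_iff[OF assms] distance_space_def pullback_def
      path_space_def topspace_compact_open_topology)

lemma time_partition_nth_bounds: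
  assumes "time_partition m ts" "i < m"
  shows "0 \<le> ts ! i" "ts ! i \<le> 1"
proof -
  have len: "length ts = m" and s: "sorted_wrt (<) ts" and ends: "hd ts = 0" "last ts = 1"
    and ne: "ts \<noteq> []"
    using assms by (auto simp: time_partition_def)
  have "ts ! 0 \<le> ts ! i"
    using sorted_wrt_nth_less[OF s, of 0 i] assms(2) len by (cases "i = 0") auto
  then show "0 \<le> ts ! i"
    using ends ne by (simp add: hd_conv_nth)
  have "ts ! i \<le> ts ! (m - 1)"
    using sorted_wrt_nth_less[OF s, of i "m - 1"] assms(2) len by (cases "i = m - 1") (auto intro: less_imp_le)
  then show "ts ! i \<le> 1"
    using ends ne len by (simp add: last_conv_nth)
qed

text \<open>
  Consecutive homotopies are run one after the other.  Letting the time range over all reals,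
  with the last homotopy continued constantly, keeps the domain fixed throughout the induction.
\<close>

lemma concatenate_homotopies:
  fixes t :: "nat \<Rightarrow> real"
  assumes "\<And>i j. i < j \<Longrightarrow> j \<le> n \<Longrightarrow> t i < t j"
    and "continuous_map X Y (g 0)"
    and "\<And>i. i < n \<Longrightarrow> homotopic_with (\<lambda>_. True) X Y (g i) (g (Suc i))"
  shows "\<exists>K. continuous_map (prod_topology euclideanreal X) Y K \<and>
    (\<forall>j\<le>n. \<forall>x\<in>topspace X. K (t j, x) = g j x)"
  using assms
proof (induction n)
  case 0
  have "continuous_map (prod_topology euclideanreal X) Y (\<lambda>z. g 0 (snd z))"
    using continuous_map_compose[OF continuous_map_snd 0(2)] by (simp only: o_def)
  then show ?case
    by (intro exI[of _ "\<lambda>z. g 0 (snd z)"]) simp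
next
  case (Suc n)
  obtain K where K: "continuous_map (prod_topology euclideanreal X) Y K"
    and Kt: "\<And>j x. j \<le> n \<Longrightarrow> x \<in> topspace X \<Longrightarrow> K (t j, x) = g j x"
    using Suc.IH Suc.prems by (metis le_SucI less_SucI)
  obtain h where h: "continuous_map (prod_topology (top_of_set {0..1::real}) X) Y h"
    and h0: "\<And>x. h (0, x) = g n x" and h1: "\<And>x. h (1, x) = g (Suc n) x"
    using Suc.prems(3)[of n] by (auto simp: homotopic_with_def)
  have tn: "t n < t (Suc n)"
    using Suc.prems(1) by simp
  let ?P = "prod_topology euclideanreal X"
  \<comment> \<open>The clock of the new homotopy: \<open>0\<close> up to time \<open>t n\<close> and \<open>1\<close> from time \<open>t (Suc n)\<close> on.\<close>
  define u where "u r = max 0 (min 1 ((r - t n) / (t (Suc n) - t n)))" for r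
  have cu: "continuous_map euclideanreal (top_of_set {0..1}) u"
    by (auto simp: continuous_map_in_subtopology u_def intro!: continuous_intros) (use tn in auto)
  have hu: "continuous_map ?P Y (\<lambda>z. h (u (fst z), snd z))"
  proof -
    have "continuous_map ?P (prod_topology (top_of_set {0..1}) X) (\<lambda>z. (u (fst z), snd z))"
      using continuous_map_compose[OF continuous_map_fst cu]
      by (intro continuous_map_pairedI continuous_map_snd) (auto simp: o_def)
    from continuous_map_compose[OF this h] show ?thesis
      by (simp add: o_def)
  qed
  have "continuous_map ?P Y (\<lambda>z. if fst z \<le> t n then K z else h (u (fst z), snd z))"
  proof (rule continuous_map_cases_le)
    fix z assume "z \<in> topspace ?P" "fst z = t n"
    then show "K z = h (u (fst z), snd z)"
      using Kt[of n "snd z"] h0 by (cases z) (auto simp: u_def)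
  qed (use K hu in \<open>auto intro: continuous_map_from_subtopology continuous_map_fst\<close>)
  moreover have "(if fst (t j, x) \<le> t n then K (t j, x) else h (u (fst (t j, x)), snd (t j, x))) = g j x"
    if j: "j \<le> Suc n" and x: "x \<in> topspace X" for j x
  proof (cases "j = Suc n")
    case True
    then show ?thesis
      using tn h1 by (simp add: u_def)
  next
    case False
    then have "j \<le> n"
      using j by simp
    moreover have "t j \<le> t n"
      using Suc.prems(1)[of j n] \<open>j \<le> n\<close> by (cases "j = n") auto
    ultimately show ?thesis
      using Kt[OF _ x] by simp
  qed
  ultimately show ?case
    by blast
qed

text \<open>
  A partial section chooses a path through the values \<open>g\<^sub>i(x)\<close>, continuously in \<open>x\<close>.  Sliding
  along this path from time \<open>t\<^sub>i\<close> to time \<open>t\<^sub>j\<close> is a homotopy from \<open>g\<^sub>i\<close> to \<open>g\<^sub>j\<close>; conversely,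
  homotopies between consecutive maps concatenate to such paths.
\<close>

lemma partial_section_distance_space_iff:
  assumes ts: "time_partition (length gs) ts" and gs: "gs \<noteq> []" and U: "U \<subseteq> topspace X"
  shows "(\<exists>s. continuous_map (subtopology X U) (distance_space ts X Y gs) s \<and> (\<forall>x\<in>U. fst (s x) = x))
    \<longleftrightarrow> (\<forall>g\<in>set gs. \<forall>h\<in>set gs. homotopic_with (\<lambda>_. True) (subtopology X U) Y g h)"
    (is "?section \<longleftrightarrow> ?homotopic")
proof
  let ?I = "top_of_set {0..1::real}"
  have len: "length gs = length ts"
    using ts by (simp add: time_partition_def)
  note topspace_E = topspace_distance_space[OF len, of X Y]
  have topU: "topspace (subtopology X U) = U"
    using U by (simp add: inf.absorb2)
  {
    assume ?section
    then obtain s where s: "continuous_map (subtopology X U) (distance_space ts X Y gs) s"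
      and fst_s: "\<And>x. x \<in> U \<Longrightarrow> fst (s x) = x"
      by blast
    have "continuous_map (distance_space ts X Y gs) (path_space Y) snd"
      unfolding distance_space_def pullback_def
      by (intro continuous_map_from_subtopology continuous_map_snd)
    then have "continuous_map (subtopology X U) (compact_open_topology ?I Y) (snd \<circ> s)"
      unfolding path_space_def by (rule continuous_map_compose[OF s])
    moreover have "locally_compact_space ?I" "Hausdorff_space ?I"
      by (auto intro!: compact_imp_locally_compact_space Hausdorff_space_subtopology
          simp: compact_space_subtopology)
    ultimately have ev: "continuous_map (prod_topology ?I (subtopology X U)) Y (\<lambda>(t, x). snd (s x) t)"
      using continuous_map_uncurry by fastforce
    have val: "snd (s x) (ts ! i) = (gs ! i) x" if "x \<in> U" "i < length gs" for x i
    proof -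
      have "s x \<in> topspace (distance_space ts X Y gs)"
        using continuous_map_image_subset_topspace[OF s] that topU by blast
      then show ?thesis
        using that fst_s[of x] len by (auto simp: topspace_E)
    qed
    show ?homotopic
    proof (intro ballI)
      fix g h assume "g \<in> set gs" "h \<in> set gs"
      then obtain i j where i: "i < length gs" "g = gs ! i" and j: "j < length gs" "h = gs ! j"
        by (metis in_set_conv_nth)
      define c where "c r = (1 - r) * ts ! i + r * ts ! j" for r
      have "c r \<in> {0..1}" if "r \<in> {0..1}" for r
        using that time_partition_nth_bounds[OF ts] i j
          convex_bound_le[of "ts ! i" 1 "ts ! j" "1 - r" r]
        by (auto simp: c_def)
      then have "continuous_map ?I ?I c"
        by (auto simp: continuous_map_in_subtopology c_def intro!: continuous_intros)
      then have "continuous_map (prod_topology ?I (subtopology X U)) ?I (\<lambda>z. c (fst z))"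
        using continuous_map_compose[OF continuous_map_fst, of ?I ?I c] unfolding o_def by blast
      then have "continuous_map (prod_topology ?I (subtopology X U)) (prod_topology ?I (subtopology X U))
          (\<lambda>z. (c (fst z), snd z))"
        by (intro continuous_map_pairedI continuous_map_snd)
      from continuous_map_compose[OF this ev]
      have H: "continuous_map (prod_topology ?I (subtopology X U)) Y (\<lambda>z. snd (s (snd z)) (c (fst z)))"
        by (simp add: o_def)
      show "homotopic_with (\<lambda>_. True) (subtopology X U) Y g h"
        using H val i j topU
        by (subst homotopic_with)
          (auto simp: c_def intro!: exI[of _ "\<lambda>z. snd (s (snd z)) (c (fst z))"])
    qed
  }
  {
    assume hom: ?homotopic
    define n where "n = length gs - 1"
    have n: "Suc n = length gs"
      using gs by (simp add: n_def)
    have "continuous_map (subtopology X U) Y (gs ! 0)"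
      using hom gs homotopic_with_imp_continuous_maps by (metis length_greater_0_conv nth_mem)
    moreover have "homotopic_with (\<lambda>_. True) (subtopology X U) Y (gs ! i) (gs ! Suc i)" if "i < n" for i
      using hom that n by (metis Suc_lessD Suc_mono nth_mem)
    moreover have "ts ! i < ts ! j" if "i < j" "j \<le> n" for i j
      using sorted_wrt_nth_less[of "(<)" ts i j] ts that n len by (auto simp: time_partition_def)
    ultimately obtain K where K: "continuous_map (prod_topology euclideanreal (subtopology X U)) Y K"
      and Kt: "\<And>j x. j \<le> n \<Longrightarrow> x \<in> U \<Longrightarrow> K (ts ! j, x) = (gs ! j) x"
      using concatenate_homotopies[of n "(!) ts" "subtopology X U" Y "(!) gs"] topU by metis
    have "continuous_map (prod_topology ?I (subtopology X U)) Y K"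
      using continuous_map_from_subtopology[OF K] by (simp add: prod_topology_subtopology(1))
    then have curry: "continuous_map (subtopology X U) (path_space Y) (\<lambda>x. \<lambda>t\<in>{0..1}. K (t, x))"
      unfolding path_space_def using continuous_map_curry[of ?I _ Y K] by simp
    let ?s = "\<lambda>x. (x, \<lambda>t\<in>{0..1}. K (t, x))"
    have "continuous_map (subtopology X U) (prod_topology X (path_space Y)) ?s"
      using curry by (intro continuous_map_pairedI) (auto intro: continuous_map_from_subtopology)
    moreover have "tuple_map gs x = path_eval ts (snd (?s x))" if "x \<in> U" for x
      using that Kt time_partition_nth_bounds[OF ts] n len
      by (auto simp: tuple_map_eq_path_eval_iff)
    ultimately have "continuous_map (subtopology X U) (distance_space ts X Y gs) ?s"
      unfolding distance_space_def pullback_def continuous_map_in_subtopology using topU by auto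
    then show ?section
      by (intro exI[of _ ?s]) simp
  }
qed

lemma secat_distance_space:
  assumes "time_partition (length gs) ts" "gs \<noteq> []"
  shows "secat (distance_space ts X Y gs) X fst = homotopic_distance X Y gs"
proof -
  have "(\<forall>j\<le>n. \<exists>s. continuous_map (subtopology X (U j)) (distance_space ts X Y gs) s \<and>
         (\<forall>b\<in>U j. fst (s b) = b))
    \<longleftrightarrow> (\<forall>j\<le>n. \<forall>g\<in>set gs. \<forall>h\<in>set gs. homotopic_with (\<lambda>_. True) (subtopology X (U j)) Y g h)"
    if "\<forall>j\<le>n. openin X (U j)" for n and U :: "nat \<Rightarrow> 'a set"
    using that by (simp add: partial_section_distance_space_iff[OF assms openin_subset])
  then show ?thesis
    unfolding secat_def homotopic_distance_def by (simp cong: conj_cong)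
qed


section \<open>Pushing forward finitely supported measures\<close>

text \<open>
  A section of \<open>p\<close> by measures is pushed forward along a fibrewise map \<open>h\<close>.  The topologies on the
  spaces of measures are left abstract, so that one argument serves the quotient topology and the
  Levy-Prokhorov topology.
\<close>

lemma dsecat_le_of_fibrewise_map:
  assumes h: "\<And>e. e \<in> topspace E \<Longrightarrow> p' (h e) = p e"
    and push: "\<And>n. continuous_map (\<T> (Suc n) E) (\<T>' (Suc n) E') (map_pmf h)"
    and supp: "\<And>n \<mu>. \<mu> \<in> topspace (\<T> (Suc n) E) \<Longrightarrow> set_pmf \<mu> \<subseteq> topspace E"
  shows "dsecat \<T>' E' B p' \<le> dsecat \<T> E B p"
  unfolding dsecat_def
proof (rule Inf_superset_mono, clarify)
  fix n s
  assume s: "continuous_map B (fiber_prob \<T> (n + 1) E B p) s"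
    and sec: "\<forall>b\<in>topspace B. fiber_proj p (s b) = b"
  have top: "s b \<in> topspace (fiber_prob \<T> (n + 1) E B p)" if "b \<in> topspace B" for b
    using continuous_map_image_subset_topspace[OF s] that by blast
  then have ph: "p' (h e) = p e" if "b \<in> topspace B" "e \<in> set_pmf (s b)" for b e
    using that supp[of "s b" n] h by (auto simp: fiber_prob_def)
  have "continuous_map B (\<T> (Suc n) E) s"
    using s by (simp add: fiber_prob_def continuous_map_in_subtopology)
  then have "continuous_map B (\<T>' (Suc n) E') (map_pmf h \<circ> s)"
    using push by (rule continuous_map_compose)
  moreover have "\<exists>c\<in>topspace B. \<forall>e'\<in>set_pmf (map_pmf h (s b)). p' e' = c" if "b \<in> topspace B" for b
    using top[OF that] ph[OF that] by (fastforce simp: fiber_prob_def)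
  ultimately have "continuous_map B (fiber_prob \<T>' (n + 1) E' B p') (map_pmf h \<circ> s)"
    by (auto simp: fiber_prob_def continuous_map_in_subtopology)
  moreover have "p' ` set_pmf (map_pmf h (s b)) = p ` set_pmf (s b)" if "b \<in> topspace B" for b
    using ph[OF that] by (force simp: image_iff)
  then have "\<forall>b\<in>topspace B. fiber_proj p' ((map_pmf h \<circ> s) b) = b"
    using sec by (simp add: fiber_proj_def)
  ultimately show "\<exists>n'. enat n = enat n' \<and>
      (\<exists>s. continuous_map B (fiber_prob \<T>' (n' + 1) E' B p') s \<and>
           (\<forall>b\<in>topspace B. fiber_proj p' (s b) = b))"
    by blast
qed

text \<open>
  A tuple in \<open>E\<^bsup>n+1\<^esup>\<close> has meaningful entries only at the indices up to \<open>n\<close>, so the push-forward of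
  \<open>w\<close> along it is a measure on \<open>E\<close> only because \<open>w\<close> puts no mass on larger indices.
\<close>

lemma set_pmf_embed_standard_simplex:
  assumes "w \<in> standard_simplex n"
  shows "set_pmf (embed_pmf w) \<subseteq> {..n}"
proof -
  have nonneg: "\<And>i. 0 \<le> w i" and zero: "\<And>i. i > n \<Longrightarrow> w i = 0" and one: "(\<Sum>i\<le>n. w i) = 1"
    using assms by (auto simp: standard_simplex_def)
  have "(\<integral>\<^sup>+i. ennreal (w i) \<partial>count_space UNIV) = (\<Sum>i\<le>n. ennreal (w i))"
    using zero by (intro nn_integral_count_space') (auto simp: not_le[symmetric])
  also have "\<dots> = 1"
    using nonneg one by (simp add: sum_ennreal)
  finally have "set_pmf (embed_pmf w) = {i. w i \<noteq> 0}"
    using nonneg by (intro set_embed_pmf)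
  then show ?thesis
    using zero by (auto simp: not_less[symmetric])
qed

lemma set_pmf_sym_join_topology:
  assumes "\<mu> \<in> topspace (sym_join_topology (Suc n) E)"
  shows "set_pmf \<mu> \<subseteq> topspace E"
proof -
  have "topspace (sym_join_topology (Suc n) E) =
      (\<lambda>(w, e). map_pmf e (embed_pmf w)) ` (standard_simplex n \<times> topspace (power_topology (Suc n) E))"
    unfolding sym_join_topology_def
    by (simp add: quotient_imp_surjective_map[OF quotient_map_quotient_topology, symmetric])
  with assms obtain w e where w: "w \<in> standard_simplex n"
    and e: "e \<in> topspace (power_topology (Suc n) E)" and \<mu>: "\<mu> = map_pmf e (embed_pmf w)"
    by auto
  show ?thesis
    using set_pmf_embed_standard_simplex[OF w] e
    by (force simp: \<mu> power_topology_def PiE_iff)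
qed

text \<open>
  On representatives \<open>(w, e)\<close> of measures, the push-forward along \<open>h\<close> applies \<open>h\<close> to every
  coordinate of \<open>e\<close>, so it descends to the quotient.
\<close>

lemma continuous_map_push_sym_join:
  assumes h: "continuous_map E E' h"
  shows "continuous_map (sym_join_topology (Suc n) E) (sym_join_topology (Suc n) E') (map_pmf h)"
proof -
  let ?\<Delta> = "subtopology (powertop_real UNIV) (standard_simplex n)"
  let ?q = "\<lambda>(w, e). map_pmf e (embed_pmf w)"
  let ?D = "prod_topology ?\<Delta> (power_topology (Suc n) E)"
  let ?D' = "prod_topology ?\<Delta> (power_topology (Suc n) E')"
  let ?h = "\<lambda>e. \<lambda>i\<in>{..<Suc n}. h (e i)"
  have q: "quotient_map ?D (sym_join_topology (Suc n) E) ?q"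
    "quotient_map ?D' (sym_join_topology (Suc n) E') ?q"
    by (simp_all add: sym_join_topology_def quotient_map_quotient_topology)
  have "continuous_map (power_topology (Suc n) E) E' (\<lambda>e. h (e i))" if "i < Suc n" for i
    using continuous_map_compose[OF continuous_map_product_projection[of i "{..<Suc n}" "\<lambda>_. E"] h] that
    by (simp only: power_topology_def o_def lessThan_iff)
  then have "continuous_map (power_topology (Suc n) E) (power_topology (Suc n) E') ?h"
    unfolding power_topology_def[of _ E'] by (auto simp: continuous_map_componentwise)
  then have "continuous_map ?D (power_topology (Suc n) E') (?h \<circ> snd)"
    by (rule continuous_map_compose[OF continuous_map_snd])
  then have "continuous_map ?D ?D' (\<lambda>z. (fst z, ?h (snd z)))"
    by (intro continuous_map_pairedI continuous_map_fst) (simp add: o_def)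
  then have "continuous_map ?D (sym_join_topology (Suc n) E') (?q \<circ> (\<lambda>z. (fst z, ?h (snd z))))"
    using quotient_imp_continuous_map[OF q(2)] by (rule continuous_map_compose)
  moreover have "(?q \<circ> (\<lambda>z. (fst z, ?h (snd z)))) z = (map_pmf h \<circ> ?q) z" if "z \<in> topspace ?D" for z
  proof (cases z)
    case (Pair w e)
    then have "set_pmf (embed_pmf w) \<subseteq> {..n}"
      using that by (intro set_pmf_embed_standard_simplex) auto
    then have "map_pmf (?h e) (embed_pmf w) = map_pmf (\<lambda>i. h (e i)) (embed_pmf w)"
      by (intro map_pmf_cong) auto
    then show ?thesis
      by (simp add: Pair pmf.map_comp o_def)
  qed
  ultimately have "continuous_map ?D (sym_join_topology (Suc n) E') (map_pmf h \<circ> ?q)"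
    by (rule continuous_map_eq)
  then show ?thesis
    by (rule continuous_compose_quotient_map[OF q(1)])
qed

lemma dsecat_sym_join_le:
  assumes "continuous_map E E' h" and "\<And>e. e \<in> topspace E \<Longrightarrow> p' (h e) = p e"
  shows "dsecat sym_join_topology E' B p' \<le> dsecat sym_join_topology E B p"
  using assms(2) continuous_map_push_sym_join[OF assms(1)] set_pmf_sym_join_topology
  by (rule dsecat_le_of_fibrewise_map)

lemma finite_in_borel_sets_of:
  assumes d: "compatible_metric d E" and A: "finite A" "A \<subseteq> topspace E"
  shows "A \<in> borel_sets_of E"
proof -
  interpret Metric_space "topspace E" d
    using d by (simp add: compatible_metric_def)
  have "Hausdorff_space E"
    using d Hausdorff_space_mtopology by (simp add: compatible_metric_def)
  then have "closedin E A"
    using A by (simp add: closedin_Hausdorff_finite)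
  then have "topspace E - (topspace E - A) \<in> borel_sets_of E"
    unfolding borel_sets_of_def by (intro sigma_sets.Compl sigma_sets.Basic) auto
  then show ?thesis
    using A(2) by (simp add: double_diff)
qed

lemma levy_prokhorov_le:
  assumes "\<epsilon> > 0"
    and "\<And>A. measure_pmf.prob \<mu> A \<le> measure_pmf.prob \<nu> (thickening E d \<epsilon> A) + \<epsilon>"
    and "\<And>A. measure_pmf.prob \<nu> A \<le> measure_pmf.prob \<mu> (thickening E d \<epsilon> A) + \<epsilon>"
  shows "levy_prokhorov E d \<mu> \<nu> \<le> \<epsilon>"
proof -
  have "bdd_below {\<epsilon>. \<epsilon> > 0 \<and> P \<epsilon>}" for P :: "real \<Rightarrow> bool"
    by (rule bdd_belowI[of _ 0]) simp
  then show ?thesis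
    unfolding levy_prokhorov_def using assms by (intro cInf_lower) simp_all
qed

lemma levy_prokhorov_lessD:
  assumes "levy_prokhorov E d \<mu> \<nu> < \<delta>" and A: "A \<in> borel_sets_of E"
  shows "measure_pmf.prob \<mu> A \<le> measure_pmf.prob \<nu> (thickening E d \<delta> A) + \<delta>"
proof -
  let ?S = "{\<epsilon>. \<epsilon> > 0 \<and> (\<forall>A \<in> borel_sets_of E.
     measure_pmf.prob \<mu> A \<le> measure_pmf.prob \<nu> (thickening E d \<epsilon> A) + \<epsilon> \<and>
     measure_pmf.prob \<nu> A \<le> measure_pmf.prob \<mu> (thickening E d \<epsilon> A) + \<epsilon>)}"
  have "measure_pmf.prob q A \<le> measure_pmf.prob r B + 1" for q r :: "'a pmf" and A B
    using measure_pmf.prob_le_1[of q A] measure_nonneg[of r B] by linarith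
  then have "1 \<in> ?S"
    by simp
  then have ne: "?S \<noteq> {}"
    by blast
  have "bdd_below ?S"
    by (intro bdd_belowI[of _ 0]) auto
  with ne obtain \<epsilon> where \<epsilon>: "\<epsilon> \<in> ?S" "\<epsilon> < \<delta>"
    using assms(1) unfolding levy_prokhorov_def by (subst (asm) cInf_less_iff) blast+
  have "measure_pmf.prob \<mu> A \<le> measure_pmf.prob \<nu> (thickening E d \<epsilon> A) + \<epsilon>"
    using \<epsilon>(1) A by blast
  also have "measure_pmf.prob \<nu> (thickening E d \<epsilon> A) \<le> measure_pmf.prob \<nu> (thickening E d \<delta> A)"
    using \<epsilon>(2) by (intro measure_pmf.finite_measure_mono) (force simp: thickening_def)+
  finally show ?thesis
    using \<epsilon>(2) by simp
qed

text \<open>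
  Near a measure \<open>\<mu>\<close> of finite support, \<open>h\<close> is controlled by one modulus of continuity \<open>\<delta>\<close> valid at
  all support points.  A measure \<open>\<nu>\<close> close to \<open>\<mu>\<close> carries at least the \<open>\<mu>\<close>-mass of any set \<open>F\<close> of
  support points, up to \<open>\<delta>\<close>, in the \<open>\<delta>\<close>-neighbourhood of \<open>F\<close>.  With \<open>F\<close> the support points over \<open>A\<close>
  this bounds the image of \<open>\<mu>\<close> by that of \<open>\<nu>\<close>; with \<open>F\<close> the support points away from the
  thickening of \<open>A\<close>, passage to complements gives the reverse bound.
\<close>

lemma continuous_map_push_levy_prokhorov:
  assumes h: "continuous_map E E' h" and d: "compatible_metric d E" and d': "compatible_metric d' E'"
  shows "continuous_map (levy_prokhorov_topology d k E) (levy_prokhorov_topology d' k E') (map_pmf h)"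
proof -
  interpret E: Metric_space "topspace E" d
    using d by (simp add: compatible_metric_def)
  interpret E': Metric_space "topspace E'" d'
    using d' by (simp add: compatible_metric_def)
  interpret LP: Metric_space "finite_prob k E" "levy_prokhorov E d"
    by (rule metric_space_levy_prokhorov[OF d])
  interpret LP': Metric_space "finite_prob k E'" "levy_prokhorov E' d'"
    by (rule metric_space_levy_prokhorov[OF d'])
  have h_top: "h e \<in> topspace E'" if "e \<in> topspace E" for e
    using h that by (auto simp: continuous_map_def)
  have "continuous_map E.mtopology E'.mtopology h"
    using h d d' by (simp add: compatible_metric_def)
  then have h_metric: "\<exists>\<delta>>0. \<forall>y. y \<in> topspace E \<and> d x y < \<delta> \<longrightarrow> d' (h x) (h y) < \<epsilon>"
    if "x \<in> topspace E" "\<epsilon> > 0" for x \<epsilon>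
    using that E.metric_continuous_map[OF E'.Metric_space_axioms, of h] by blast
  have push_top: "map_pmf h \<mu> \<in> finite_prob k E'" if "\<mu> \<in> finite_prob k E" for \<mu>
    using that h_top card_image_le[of "set_pmf \<mu>" h]
    by (auto simp: finite_prob_def intro: le_trans)
  have "\<exists>\<delta>>0. \<forall>\<nu>. \<nu> \<in> finite_prob k E \<and> levy_prokhorov E d \<mu> \<nu> < \<delta>
      \<longrightarrow> levy_prokhorov E' d' (map_pmf h \<mu>) (map_pmf h \<nu>) < \<epsilon>"
    if \<mu>: "\<mu> \<in> finite_prob k E" and "\<epsilon> > 0" for \<mu> \<epsilon>
  proof -
    have fin: "finite (set_pmf \<mu>)" and supp: "set_pmf \<mu> \<subseteq> topspace E"
      using \<mu> by (auto simp: finite_prob_def)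
    define \<eta> where "\<eta> = \<epsilon> / 2"
    have \<eta>: "\<eta> > 0" "\<eta> < \<epsilon>"
      using \<open>\<epsilon> > 0\<close> by (auto simp: \<eta>_def)
    obtain D where D: "\<And>x. x \<in> set_pmf \<mu> \<Longrightarrow> D x > 0"
      "\<And>x y. x \<in> set_pmf \<mu> \<Longrightarrow> y \<in> topspace E \<Longrightarrow> d x y < D x \<Longrightarrow> d' (h x) (h y) < \<eta>"
      using h_metric[OF _ \<eta>(1)] supp by (metis subsetD)
    define \<delta> where "\<delta> = Min (insert \<eta> (D ` set_pmf \<mu>))"
    have \<delta>: "\<delta> > 0" "\<delta> \<le> \<eta>" "\<And>x. x \<in> set_pmf \<mu> \<Longrightarrow> \<delta> \<le> D x"
      using fin D(1) \<eta>(1) by (auto simp: \<delta>_def)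
    have near: "d' (h x) (h y) < \<eta>" if "x \<in> set_pmf \<mu>" "y \<in> topspace E" "d x y < \<delta>" for x y
      using D(2)[OF that(1,2)] \<delta>(3)[OF that(1)] that(3) by linarith
    have "levy_prokhorov E' d' (map_pmf h \<mu>) (map_pmf h \<nu>) < \<epsilon>"
      if \<nu>: "\<nu> \<in> finite_prob k E" and lp: "levy_prokhorov E d \<mu> \<nu> < \<delta>" for \<nu>
    proof -
      have mass: "measure_pmf.prob \<mu> F \<le> measure_pmf.prob \<nu> (thickening E d \<delta> F) + \<delta>"
        if "F \<subseteq> set_pmf \<mu>" for F
        using that fin supp
        by (intro levy_prokhorov_lessD[OF lp] finite_in_borel_sets_of[OF d]) (auto intro: finite_subset)
      have "levy_prokhorov E' d' (map_pmf h \<mu>) (map_pmf h \<nu>) \<le> \<eta>"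
      proof (rule levy_prokhorov_le[OF \<eta>(1)])
        fix A
        define T where "T = thickening E' d' \<eta> A"
        have "measure_pmf.prob \<mu> (h -` A) = measure_pmf.prob \<mu> (h -` A \<inter> set_pmf \<mu>)"
          by (simp add: measure_Int_set_pmf)
        also have "\<dots> \<le> measure_pmf.prob \<nu> (thickening E d \<delta> (h -` A \<inter> set_pmf \<mu>)) + \<delta>"
          by (intro mass) simp
        also have "measure_pmf.prob \<nu> (thickening E d \<delta> (h -` A \<inter> set_pmf \<mu>))
            \<le> measure_pmf.prob \<nu> (h -` T)"
          using near h_top
          by (intro measure_pmf.finite_measure_mono) (auto simp: thickening_def T_def)
        finally show "measure_pmf.prob (map_pmf h \<mu>) A
            \<le> measure_pmf.prob (map_pmf h \<nu>) (thickening E' d' \<eta> A) + \<eta>"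
          using \<delta>(2) by (simp add: T_def)
        define F where "F = set_pmf \<mu> - h -` T"
        have disj: "h -` A \<inter> thickening E d \<delta> F = {}"
        proof (rule ccontr)
          assume "h -` A \<inter> thickening E d \<delta> F \<noteq> {}"
          then obtain x y where xy: "h y \<in> A" "y \<in> topspace E" "x \<in> F" "d x y < \<delta>"
            by (auto simp: thickening_def)
          then have "d' (h y) (h x) < \<eta>" "h x \<in> topspace E'"
            using near[of x y] h_top supp E'.commute[of "h x" "h y"] by (auto simp: F_def)
          then have "h x \<in> T"
            using xy(1) by (auto simp: T_def thickening_def)
          then show False
            using xy(3) by (simp add: F_def)
        qed
        have "measure_pmf.prob \<nu> (h -` A) + measure_pmf.prob \<nu> (thickening E d \<delta> F)
            = measure_pmf.prob \<nu> (h -` A \<union> thickening E d \<delta> F)"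
          using disj by (intro measure_pmf.finite_measure_Union[symmetric]) auto
        also have "\<dots> \<le> 1"
          by (rule measure_pmf.prob_le_1)
        finally have "measure_pmf.prob \<nu> (h -` A) + measure_pmf.prob \<mu> F \<le> 1 + \<delta>"
          using mass[of F] by (auto simp: F_def)
        moreover have "measure_pmf.prob \<mu> F = 1 - measure_pmf.prob \<mu> (h -` T)"
        proof -
          have "measure_pmf.prob \<mu> F = measure_pmf.prob \<mu> (- (h -` T) \<inter> set_pmf \<mu>)"
            unfolding F_def by (rule arg_cong[where f = "measure_pmf.prob \<mu>"]) blast
          also have "\<dots> = measure_pmf.prob \<mu> (- (h -` T))"
            by (rule measure_Int_set_pmf)
          finally show ?thesis
            using measure_pmf.prob_compl[of "h -` T" \<mu>] by (simp add: Compl_eq_Diff_UNIV)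
        qed
        ultimately show "measure_pmf.prob (map_pmf h \<nu>) A
            \<le> measure_pmf.prob (map_pmf h \<mu>) (thickening E' d' \<eta> A) + \<eta>"
          using \<delta>(2) by (simp add: T_def)
      qed
      then show ?thesis
        using \<eta>(2) by simp
    qed
    then show ?thesis
      using \<delta>(1) by blast
  qed
  then show ?thesis
    unfolding levy_prokhorov_topology_def LP.metric_continuous_map[OF LP'.Metric_space_axioms]
    using push_top by blast
qed

lemma dsecat_levy_prokhorov_le:
  assumes "continuous_map E E' h" and "\<And>e. e \<in> topspace E \<Longrightarrow> p' (h e) = p e"
    and d: "compatible_metric d E" and "compatible_metric d' E'"
  shows "dsecat (levy_prokhorov_topology d') E' B p' \<le> dsecat (levy_prokhorov_topology d) E B p"
proof (rule dsecat_le_of_fibrewise_map[where h = h])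
  fix n \<mu> assume "\<mu> \<in> topspace (levy_prokhorov_topology d (Suc n) E)"
  then show "set_pmf \<mu> \<subseteq> topspace E"
    by (simp add: levy_prokhorov_topology_def
        Metric_space.topspace_mtopology[OF metric_space_levy_prokhorov[OF d]])
      (simp add: finite_prob_def)
qed (use assms continuous_map_push_levy_prokhorov in auto)

lemma dsecat_levy_prokhorov_metric_independent:
  assumes "compatible_metric d E" "compatible_metric d' E"
  shows "dsecat (levy_prokhorov_topology d) E B p = dsecat (levy_prokhorov_topology d') E B p"
  by (rule antisym; rule dsecat_levy_prokhorov_le[where h = id]) (simp_all add: assms)


section \<open>Comparison of the total spaces\<close>

lemma cat_space_eq_distance_space:
  "cat_space X Y y0 f = distance_space [0, 1] X Y [f, \<lambda>_. y0]"
proof -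
  have iff: "tuple_map [f, \<lambda>_. y0] x = path_eval [0, 1] \<gamma> \<longleftrightarrow> f x = \<gamma> 0 \<and> \<gamma> 1 = y0" for x \<gamma>
    by (auto simp: tuple_map_eq_path_eval_iff All_less_Suc)
  have "prod_topology X (based_path_space Y y0) =
      subtopology (prod_topology X (path_space Y)) (UNIV \<times> {\<gamma>. \<gamma> 1 = y0})"
    by (simp add: based_path_space_def subtopology_Times)
  then show ?thesis
    unfolding cat_space_def distance_space_def pullback_def
    by (simp add: subtopology_subtopology iff) (rule arg_cong[where f = "subtopology _"], auto)
qed

lemma TC_space_eq_distance_space:
  "TC_space m ts X Y f = distance_space ts (power_topology m X) Y (map (\<lambda>i. f \<circ> pr i) [0..<m])"
proof -
  have "power_map m f = tuple_map (map (\<lambda>i. f \<circ> pr i) [0..<m])"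
    by (auto simp: fun_eq_iff power_map_def tuple_map_def pr_def restrict_def)
  then show ?thesis
    by (simp add: TC_space_def distance_space_def)
qed

definition reverse_path :: "(real \<Rightarrow> 'y) \<Rightarrow> real \<Rightarrow> 'y" where
  "reverse_path \<gamma> = (\<lambda>t\<in>{0..1}. \<gamma> (1 - t))"

lemma continuous_map_reverse_path_distance_space:
  "continuous_map (distance_space [0, 1] X Y [g, h]) (distance_space [0, 1] X Y [h, g])
     (\<lambda>(x, \<gamma>). (x, reverse_path \<gamma>))"
proof -
  let ?I = "top_of_set {0..1::real}"
  let ?E = "distance_space [0, 1] X Y [g, h]"
  have "continuous_map ?I ?I (\<lambda>t. 1 - t)"
    by (auto simp: continuous_map_in_subtopology intro!: continuous_intros)
  then have rev: "continuous_map (path_space Y) (path_space Y) reverse_path"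
    unfolding path_space_def reverse_path_def
    using continuous_map_precompose[of ?I ?I _ Y] by simp
  have "continuous_map ?E (prod_topology X (path_space Y)) (\<lambda>z. (fst z, reverse_path (snd z)))"
    unfolding distance_space_def pullback_def
    using continuous_map_compose[OF continuous_map_snd rev]
    by (intro continuous_map_from_subtopology continuous_map_pairedI continuous_map_fst)
      (auto simp: o_def)
  moreover have "tuple_map [h, g] x = path_eval [0, 1] (reverse_path \<gamma>)"
    if "(x, \<gamma>) \<in> topspace ?E" for x \<gamma>
    using that
    by (simp add: topspace_distance_space tuple_map_eq_path_eval_iff All_less_Suc reverse_path_def)
  ultimately show ?thesis
    unfolding distance_space_def[of _ _ _ "[h, g]"] pullback_def
    by (auto simp: continuous_map_in_subtopology case_prod_unfold)
qed

lemma dhomotopic_distance_sym_join_commute: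
  "dhomotopic_distance sym_join_topology [0, 1] X Y [g, h] =
   dhomotopic_distance sym_join_topology [0, 1] X Y [h, g]"
  unfolding dhomotopic_distance_def
  by (rule antisym; rule dsecat_sym_join_le[OF continuous_map_reverse_path_distance_space])
    (simp_all add: case_prod_unfold)

lemma dhomotopic_distance_levy_prokhorov_commute:
  assumes "compatible_metric d (distance_space [0, 1] X Y [g, h])"
    and "compatible_metric d' (distance_space [0, 1] X Y [h, g])"
  shows "dhomotopic_distance (levy_prokhorov_topology d) [0, 1] X Y [g, h] =
    dhomotopic_distance (levy_prokhorov_topology d') [0, 1] X Y [h, g]"
  unfolding dhomotopic_distance_def
  by (rule antisym; rule dsecat_levy_prokhorov_le[OF continuous_map_reverse_path_distance_space])
    (simp_all add: case_prod_unfold assms)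

lemma homotopic_distance_commute:
  "homotopic_distance X Y [g, h] = homotopic_distance X Y [h, g]"
proof -
  have "set [g, h] = set [h, g]"
    by auto
  then show ?thesis
    unfolding homotopic_distance_def by presburger
qed


section \<open>Category and topological complexity as homotopic distances\<close>

theorem proposition3p2:
  fixes X :: "'x topology" and Y :: "'y topology" and f :: "'x \<Rightarrow> 'y" and y0 :: 'y
    and m :: nat and ts :: "real list"
  assumes "continuous_map X Y f" and "y0 \<in> topspace Y"
    and "m \<ge> 2" and "time_partition m ts"
  shows
    "(cat_map X Y y0 f = homotopic_distance X Y [f, \<lambda>_. y0] \<and>
      homotopic_distance X Y [f, \<lambda>_. y0] = homotopic_distance X Y [\<lambda>_. y0, f])
   \<and> (dcat_map sym_join_topology X Y y0 f =
        dhomotopic_distance sym_join_topology [0, 1] X Y [f, \<lambda>_. y0] \<and>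
      dhomotopic_distance sym_join_topology [0, 1] X Y [f, \<lambda>_. y0] =
        dhomotopic_distance sym_join_topology [0, 1] X Y [\<lambda>_. y0, f])
   \<and> (\<forall>d d1 d2.
        compatible_metric d (cat_space X Y y0 f) \<and>
        compatible_metric d1 (distance_space [0, 1] X Y [f, \<lambda>_. y0]) \<and>
        compatible_metric d2 (distance_space [0, 1] X Y [\<lambda>_. y0, f]) \<longrightarrow>
        dcat_map (levy_prokhorov_topology d) X Y y0 f =
          dhomotopic_distance (levy_prokhorov_topology d1) [0, 1] X Y [f, \<lambda>_. y0] \<and>
        dhomotopic_distance (levy_prokhorov_topology d1) [0, 1] X Y [f, \<lambda>_. y0] =
          dhomotopic_distance (levy_prokhorov_topology d2) [0, 1] X Y [\<lambda>_. y0, f])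
   \<and> TC_map m ts X Y f =
        homotopic_distance (power_topology m X) Y (map (\<lambda>i. f \<circ> pr i) [0..<m])
   \<and> dTC_map sym_join_topology m ts X Y f =
        dhomotopic_distance sym_join_topology ts (power_topology m X) Y
          (map (\<lambda>i. f \<circ> pr i) [0..<m])
   \<and> (\<forall>d d'.
        compatible_metric d (TC_space m ts X Y f) \<and>
        compatible_metric d'
          (distance_space ts (power_topology m X) Y (map (\<lambda>i. f \<circ> pr i) [0..<m])) \<longrightarrow>
        dTC_map (levy_prokhorov_topology d) m ts X Y f =
          dhomotopic_distance (levy_prokhorov_topology d') ts (power_topology m X) Y
            (map (\<lambda>i. f \<circ> pr i) [0..<m]))"
proof (intro conjI allI impI; (elim conjE)?)
  have "time_partition (length [f, \<lambda>_. y0]) [0, 1]"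
    by (simp add: time_partition_def)
  then show "cat_map X Y y0 f = homotopic_distance X Y [f, \<lambda>_. y0]"
    by (simp add: cat_map_def cat_space_eq_distance_space secat_distance_space)
  show "homotopic_distance X Y [f, \<lambda>_. y0] = homotopic_distance X Y [\<lambda>_. y0, f]"
    by (rule homotopic_distance_commute)
  show "dcat_map sym_join_topology X Y y0 f =
      dhomotopic_distance sym_join_topology [0, 1] X Y [f, \<lambda>_. y0]"
    by (simp add: dcat_map_def dhomotopic_distance_def cat_space_eq_distance_space)
  show "dhomotopic_distance sym_join_topology [0, 1] X Y [f, \<lambda>_. y0] =
      dhomotopic_distance sym_join_topology [0, 1] X Y [\<lambda>_. y0, f]"
    by (rule dhomotopic_distance_sym_join_commute)
next
  fix d d1 d2
  assume d: "compatible_metric d (cat_space X Y y0 f)"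
    and d1: "compatible_metric d1 (distance_space [0, 1] X Y [f, \<lambda>_. y0])"
    and d2: "compatible_metric d2 (distance_space [0, 1] X Y [\<lambda>_. y0, f])"
  show "dcat_map (levy_prokhorov_topology d) X Y y0 f =
      dhomotopic_distance (levy_prokhorov_topology d1) [0, 1] X Y [f, \<lambda>_. y0]"
    using dsecat_levy_prokhorov_metric_independent[OF d[unfolded cat_space_eq_distance_space] d1]
    by (simp add: dcat_map_def dhomotopic_distance_def cat_space_eq_distance_space)
  show "dhomotopic_distance (levy_prokhorov_topology d1) [0, 1] X Y [f, \<lambda>_. y0] =
      dhomotopic_distance (levy_prokhorov_topology d2) [0, 1] X Y [\<lambda>_. y0, f]"
    by (rule dhomotopic_distance_levy_prokhorov_commute[OF d1 d2])
next
  show "TC_map m ts X Y f =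
      homotopic_distance (power_topology m X) Y (map (\<lambda>i. f \<circ> pr i) [0..<m])"
    using assms(3,4) by (simp add: TC_map_def TC_space_eq_distance_space secat_distance_space)
  show "dTC_map sym_join_topology m ts X Y f =
      dhomotopic_distance sym_join_topology ts (power_topology m X) Y (map (\<lambda>i. f \<circ> pr i) [0..<m])"
    by (simp add: dTC_map_def dhomotopic_distance_def TC_space_eq_distance_space)
next
  fix d d'
  assume d: "compatible_metric d (TC_space m ts X Y f)"
    and d': "compatible_metric d'
      (distance_space ts (power_topology m X) Y (map (\<lambda>i. f \<circ> pr i) [0..<m]))"
  show "dTC_map (levy_prokhorov_topology d) m ts X Y f =
      dhomotopic_distance (levy_prokhorov_topology d') ts (power_topology m X) Y
        (map (\<lambda>i. f \<circ> pr i) [0..<m])"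
    using dsecat_levy_prokhorov_metric_independent[OF d[unfolded TC_space_eq_distance_space] d']
    by (simp add: dTC_map_def dhomotopic_distance_def TC_space_eq_distance_space)
qed

end
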